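(* There is an absolute constant $C>0$ such that for every odd prime $p$ there exists a transversal of $B_p$, different from the main diagonal $\{(i,i,2i): i\in\mathbb{Z}_p\}$, containing at most $C\log p$ triples $(r,c,s)$ with $r\neq c$.
   Context: $B_p$ is the Latin square of order $p$ viewed as the set of triples $\{(i,j,i+j \bmod p): i,j\in\mathbb{Z}_p\}$ (row, column, symbol). A transversal of a Latin square of order $p$ is a set of $p$ of its triples that contains each row, each column and each symbol exactly once. The main diagonal consists of the cells $(i,i)$. *)

theory Defs
  imports Complex_Main "HOL-Computational_Algebra.Primes"
begin

text \<open>Z_p is represented by {0..<p}; triples are (row, column, symbol).\<close>

definition cyclic_square :: "nat \<Rightarrow> (nat \<times> nat \<times> nat) set" where
  "cyclic_square p = {(i, j, (i + j) mod p) | i j. i < p \<and> j < p}"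

definition is_transversal :: "nat \<Rightarrow> (nat \<times> nat \<times> nat) set \<Rightarrow> (nat \<times> nat \<times> nat) set \<Rightarrow> bool" where
  "is_transversal p L T \<longleftrightarrow>
     T \<subseteq> L \<and> card T = p \<and>
     (\<forall>r<p. \<exists>!t\<in>T. fst t = r) \<and>
     (\<forall>c<p. \<exists>!t\<in>T. fst (snd t) = c) \<and>
     (\<forall>s<p. \<exists>!t\<in>T. snd (snd t) = s)"

definition main_diagonal :: "nat \<Rightarrow> (nat \<times> nat \<times> nat) set" where
  "main_diagonal p = {(i, i, (2 * i) mod p) | i. i < p}"

end

theory Submission
  imports Defs "HOL-Number_Theory.Cong"
begin

text \<open>
A permutation \<open>f\<close> of \<open>Z_p\<close> with \<open>f x - f (- x) = 2 x\<close> for all \<open>x\<close> yields the transversal of all triples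
\<open>(f x, - f (- x), 2 x)\<close>, whose off-diagonal triples come from points \<open>x\<close> with \<open>x\<close> or \<open>- x\<close> moved by \<open>f\<close>.
So it suffices to permute a nonempty set \<open>S = - S\<close> of size \<open>O(log p)\<close> in this way.

The set \<open>S\<close> consists of an arithmetic progression \<open>q\<close> of small odd numbers, of the pairs \<open>q_j + d_j\<close>,
\<open>q_j - d_j\<close> where \<open>d_(j+1)\<close> is \<open>2 d_j - 2\<close> or \<open>- 2 d_j - 2\<close>, of four further numbers that close the
configuration where \<open>d\<close> is small, and of all negatives. The choice of the sign at each step works like a
binary digit, so after \<open>log_2 p + O(1)\<close> steps one can reach \<open>d_L = 1\<close> modulo \<open>p\<close>, and this closes the
configuration at the other end.

That the elements of \<open>S\<close> are distinct modulo \<open>p\<close> is a parity argument: \<open>2^i d_(L-i)\<close> is congruent to an odd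
number of absolute value below \<open>2^(i+1)\<close>. A coincidence, multiplied by a suitable \<open>2^i\<close>, would make an odd number
divisible by \<open>p\<close>. This is impossible when that number is smaller than \<open>p\<close>; otherwise \<open>L - i\<close> is so small
that the numbers involved are integers much smaller than \<open>p\<close>, and these are distinct because \<open>\<bar>d_j\<bar>\<close>
roughly doubles at each step.
\<close>

section \<open>Transversals from permutations\<close>

lemma is_transversal_image:
  assumes r: "bij_betw r {..<p} {..<p}" and c: "bij_betw c {..<p} {..<p}"
    and s: "bij_betw s {..<p} {..<p}" and sum: "\<And>x. x < p \<Longrightarrow> (r x + c x) mod p = s x"
  shows "is_transversal p (cyclic_square p) ((\<lambda>x. (r x, c x, s x)) ` {..<p})" (is "is_transversal p _ ?T")
proof -
  have ex1: "\<exists>!t\<in>?T. g t = y" if g: "bij_betw (\<lambda>x. g (r x, c x, s x)) {..<p} {..<p}" and "y < p"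
    for g :: "nat \<times> nat \<times> nat \<Rightarrow> nat" and y
  proof -
    obtain x where x: "x < p" "g (r x, c x, s x) = y"
      using g \<open>y < p\<close> unfolding bij_betw_def by (metis (no_types, lifting) imageE lessThan_iff)
    show ?thesis
    proof (rule ex1I[of _ "(r x, c x, s x)"])
      show "(r x, c x, s x) \<in> ?T \<and> g (r x, c x, s x) = y" using x by auto
    next
      fix t assume "t \<in> ?T \<and> g t = y"
      then obtain x' where "x' < p" "t = (r x', c x', s x')" "g (r x', c x', s x') = y" by auto
      with x inj_onD[OF bij_betw_imp_inj_on[OF g], of x' x] show "t = (r x, c x, s x)" by auto
    qed
  qed
  have "inj_on (\<lambda>x. (r x, c x, s x)) {..<p}"
    using bij_betw_imp_inj_on[OF r] by (auto simp: inj_on_def)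
  then have "card ?T = p" by (simp add: card_image)
  moreover have "?T \<subseteq> cyclic_square p"
    using sum bij_betwE[OF r] bij_betwE[OF c] by (fastforce simp: cyclic_square_def)
  ultimately show ?thesis
    unfolding is_transversal_def using ex1[of fst] ex1[of "\<lambda>t. fst (snd t)"] ex1[of "\<lambda>t. snd (snd t)"] r c s
    by simp
qed

text \<open>A pair \<open>(u, b)\<close> represents the residue of \<open>v u\<close> if \<open>b\<close> holds and of \<open>- v u\<close> otherwise.\<close>

definition signed :: "('a \<Rightarrow> int) \<Rightarrow> 'a \<times> bool \<Rightarrow> int" where
  "signed v x = (if snd x then v (fst x) else - v (fst x))"

text \<open>Oddness of \<open>p\<close> makes doubling a bijection of the residues, so the symbols
  \<open>2 x\<close> are distinct. Stating \<open>diff\<close> at positive signs suffices: at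
  negative signs both sides are negated.\<close>

lemma transversal_of_signed_permutation:
  fixes v :: "'a \<Rightarrow> int" and \<rho> :: "'a \<times> bool \<Rightarrow> 'a \<times> bool"
  assumes p: "odd p" and U: "finite U"
    and inj: "inj_on (\<lambda>x. signed v x mod int p) (U \<times> UNIV)"
    and surj: "\<rho> ` (U \<times> UNIV) = U \<times> UNIV"
    and diff: "\<And>u. u \<in> U \<Longrightarrow> [signed v (\<rho> (u, True)) - signed v (\<rho> (u, False)) = 2 * v u] (mod int p)"
    and x0: "x0 \<in> U \<times> UNIV" "\<rho> x0 \<noteq> x0"
  shows "\<exists>T. is_transversal p (cyclic_square p) T \<and> T \<noteq> main_diagonal p \<and>
           card {t \<in> T. fst t \<noteq> fst (snd t)} \<le> 2 * card U"
proof -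
  define E where "E = U \<times> (UNIV :: bool set)"
  define a where "a x = nat (signed v x mod int p)" for x
  define neg where "neg x = nat ((- int x) mod int p)" for x :: nat
  define F where "F x = (if x \<in> a ` E then a (\<rho> (inv_into E a x)) else x)" for x
  have p0: "int p > 0" using p by (cases p) auto
  have finE: "finite E" using U by (simp add: E_def)
  have inta: "int (a x) = signed v x mod int p" for x
    using p0 by (simp add: a_def)
  have inja: "inj_on a E"
    unfolding inj_on_def
  proof (intro ballI impI)
    fix x y assume xy: "x \<in> E" "y \<in> E" "a x = a y"
    then have "signed v x mod int p = signed v y mod int p" using inta by metis
    then show "x = y" using inj xy by (auto simp: inj_on_def E_def)
  qed
  have alt: "a x < p" for x
    using p0 by (simp add: a_def nat_less_iff)
  have intneg: "int (neg x) = (- int x) mod int p" for x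
    using p0 by (simp add: neg_def)
  have neglt: "neg x < p" for x
    using p0 by (simp add: neg_def nat_less_iff)
  have negneg: "neg (neg x) = x" if "x < p" for x
  proof -
    have "int (neg (neg x)) = int x mod int p"
      by (simp add: intneg mod_minus_eq)
    then show ?thesis using that by simp
  qed
  have neg_bij: "bij_betw neg {..<p} {..<p}"
    by (rule bij_betw_byWitness[of _ neg]) (auto simp: negneg neglt)
  have nega: "neg (a (u, b)) = a (u, \<not> b)" for u b
  proof -
    have "int (neg (a (u, b))) = int (a (u, \<not> b))"
      by (simp add: intneg inta mod_minus_eq signed_def)
    then show ?thesis by simp
  qed
  have \<rho>E: "\<rho> x \<in> E" if "x \<in> E" for x
    using surj that by (auto simp: E_def)
  have \<rho>inj: "inj_on \<rho> E"
    using finE surj by (simp add: E_def eq_card_imp_inj_on)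
  have Fa: "F (a x) = a (\<rho> x)" if "x \<in> E" for x
    using that inja by (simp add: F_def)
  have F_bij: "bij_betw F {..<p} {..<p}"
  proof -
    have "bij_betw F (a ` E) (a ` E)"
      unfolding bij_betw_def
    proof
      show "inj_on F (a ` E)"
      proof (rule inj_onI)
        fix y y' assume "y \<in> a ` E" "y' \<in> a ` E" and eq: "F y = F y'"
        then obtain x x' where x: "x \<in> E" "y = a x" "x' \<in> E" "y' = a x'" by blast
        then have "a (\<rho> x) = a (\<rho> x')" using eq Fa by simp
        then have "\<rho> x = \<rho> x'" using inja \<rho>E x by (meson inj_onD)
        then show "y = y'" using \<rho>inj x by (metis inj_onD)
      qed
      have "F ` a ` E = a ` \<rho> ` E"
        by (auto simp: image_image Fa)
      then show "F ` a ` E = a ` E" using surj by (simp add: E_def)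
    qed
    moreover have "bij_betw F ({..<p} - a ` E) ({..<p} - a ` E)"
      by (rule bij_betw_cong[THEN iffD1, OF _ bij_betw_id]) (auto simp: F_def)
    ultimately have "bij_betw F (a ` E \<union> ({..<p} - a ` E)) (a ` E \<union> ({..<p} - a ` E))"
      by (rule bij_betw_combine) auto
    moreover have "a ` E \<union> ({..<p} - a ` E) = {..<p}" using alt by auto
    ultimately show ?thesis by simp
  qed
  define c where "c x = neg (F (neg x))" for x
  define s where "s x = (2 * x) mod p" for x
  have c_bij: "bij_betw c {..<p} {..<p}"
    unfolding c_def using bij_betw_trans[OF bij_betw_trans[OF neg_bij F_bij] neg_bij] by (simp add: o_def)
  have half: "x = y" if "[2 * x = 2 * y] (mod p)" "x < p" "y < p" for x y :: nat
  proof -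
    have "coprime p 2" using p by (simp add: coprime_commute)
    then have "[x = y] (mod p)" using that(1) by (metis cong_mult_lcancel_nat coprime_commute)
    then show ?thesis using that by (simp add: cong_def)
  qed
  have s_bij: "bij_betw s {..<p} {..<p}"
  proof -
    have "inj_on s {..<p}"
      by (intro inj_onI half) (simp_all add: s_def cong_def)
    moreover have "s ` {..<p} \<subseteq> {..<p}" using p0 by (auto simp: s_def)
    ultimately show ?thesis
      by (simp add: bij_betw_def endo_inj_surj)
  qed
  \<comment> \<open>The residues coming from \<open>E\<close> are closed under negation, so
    \<open>F\<close> fixes \<open>neg x\<close> together with \<open>x\<close>.\<close>
  have out: "F x = x \<and> c x = x" if "x < p" "x \<notin> a ` E" for x
  proof -
    have "neg x \<notin> a ` E"
    proof
      assume "neg x \<in> a ` E"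
      then obtain u b where "neg x = a (u, b)" "u \<in> U" by (auto simp: E_def)
      then have "x = a (u, \<not> b)" using nega negneg[OF that(1)] by metis
      then show False using that \<open>u \<in> U\<close> by (auto simp: E_def)
    qed
    then show ?thesis using that negneg by (simp add: c_def F_def)
  qed
  have sum: "(F x + c x) mod p = s x" if x: "x < p" for x
  proof (cases "x \<in> a ` E")
    case False
    then show ?thesis using out[OF x] by (simp add: s_def mult_2)
  next
    case True
    then obtain u b where u: "x = a (u, b)" "u \<in> U" by (auto simp: E_def)
    then have inE: "(u, b) \<in> E" "(u, \<not> b) \<in> E" by (auto simp: E_def)
    have Fx: "F x = a (\<rho> (u, b))" using u inE by (simp add: Fa)
    have cx: "c x = neg (a (\<rho> (u, \<not> b)))" using u inE by (simp add: c_def nega Fa)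
    have "[int (F x) + int (c x) = signed v (\<rho> (u, b)) - signed v (\<rho> (u, \<not> b))] (mod int p)"
      unfolding Fx cx intneg inta by (simp add: cong_def mod_simps)
    also have "[signed v (\<rho> (u, b)) - signed v (\<rho> (u, \<not> b)) = 2 * signed v (u, b)] (mod int p)"
    proof (cases b)
      case True
      then show ?thesis using diff[OF u(2)] by (simp add: signed_def)
    next
      case False
      have "[- (signed v (\<rho> (u, True)) - signed v (\<rho> (u, False))) = - (2 * v u)] (mod int p)"
        using diff[OF u(2)] by (rule cong_uminus)
      then show ?thesis using False by (simp add: signed_def)
    qed
    also have "[2 * signed v (u, b) = 2 * int x] (mod int p)"
      unfolding u(1) inta by (simp add: cong_def mod_simps)
    finally have "[int (F x + c x) = int (2 * x)] (mod int p)" by simp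
    then have "[F x + c x = 2 * x] (mod p)" by (simp only: cong_int_iff)
    then show ?thesis by (simp add: cong_def s_def)
  qed
  let ?T = "(\<lambda>x. (F x, c x, s x)) ` {..<p}"
  have "is_transversal p (cyclic_square p) ?T"
    using F_bij c_bij s_bij sum by (rule is_transversal_image)
  moreover have "?T \<noteq> main_diagonal p"
  proof
    assume T: "?T = main_diagonal p"
    have "x0 \<in> E" using x0 by (simp add: E_def)
    then have "a (\<rho> x0) \<noteq> a x0"
      using inja \<rho>E x0(2) by (metis inj_onD)
    then have "F (a x0) \<noteq> a x0" using Fa \<open>x0 \<in> E\<close> by simp
    moreover have "(F (a x0), c (a x0), s (a x0)) \<in> main_diagonal p"
      using T alt by blast
    \<comment> \<open>If the triple at \<open>a x0\<close> were diagonal, twice its row would be the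
      symbol \<open>2 * a x0\<close>, so the row would be \<open>a x0\<close>, a point that
      \<open>F\<close> moves.\<close>
    then have "F (a x0) = c (a x0)" by (auto simp: main_diagonal_def)
    then have "[2 * F (a x0) = 2 * a x0] (mod p)"
      using sum[OF alt, of x0] by (simp add: cong_def s_def mult_2)
    then have "F (a x0) = a x0"
      using half alt bij_betwE[OF F_bij] by blast
    ultimately show False by simp
  qed
  moreover have "card {t \<in> ?T. fst t \<noteq> fst (snd t)} \<le> 2 * card U"
  proof -
    have "{t \<in> ?T. fst t \<noteq> fst (snd t)} \<subseteq> (\<lambda>x. (F x, c x, s x)) ` a ` E"
      using out by fastforce
    then have "card {t \<in> ?T. fst t \<noteq> fst (snd t)} \<le> card ((\<lambda>x. (F x, c x, s x)) ` a ` E)"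
      using finE by (intro card_mono) auto
    also have "\<dots> \<le> card E"
      using finE by (meson card_image_le finite_imageI le_trans)
    also have "\<dots> = 2 * card U" by (simp add: E_def card_cartesian_product)
    finally show ?thesis .
  qed
  ultimately show ?thesis by blast
qed

section \<open>The configuration\<close>

text \<open>\<open>Q k\<close> stands for \<open>q_(k-2)\<close>, so the pair \<open>A j\<close>, \<open>B j\<close> has midpoint \<open>Q (j + 2)\<close>; \<open>G1, \<dots>, G4\<close> are the four numbers
  that close the configuration at \<open>j = 0\<close>.\<close>

datatype vertex = Q nat | A nat | B nat | G1 | G2 | G3 | G4

text \<open>\<open>2 * t = L + 2\<close> makes the progression end in 7, 5, 3, as the closing at
  \<open>j = L\<close> requires. The bound \<open>p_large\<close> comes from using
  \<open>w_le_of_large\<close> twice in a row in \<open>not_dvd_w_diff\<close>, first with the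
  constant \<open>8 * t + 2\<close>, then with one containing the bound just obtained; a factor 2
  accounts for taking a difference.\<close>

locale chain =
  fixes p :: nat and t :: int and L :: nat and d :: "nat \<Rightarrow> int" and e :: "nat \<Rightarrow> bool"
  assumes odd_p: "odd p" and L: "2 * t = int L + 2"
    and d_0: "d 0 = 12 * t + 6"
    and d_Suc: "\<And>j. j < L \<Longrightarrow> d (Suc j) = (if e j then 2 * d j - 2 else - 2 * d j - 2)"
    and d_L: "[d L = 1] (mod int p)"
    and t_ge: "t \<ge> 3"
    and L_le: "2 ^ L \<le> 8 * int p"
    and p_large: "16 * (8 * (8 * t + 2) * (16 * t + 8) + 4 * t + 1) * (16 * t + 8) < int p"
begin

definition q :: "nat \<Rightarrow> int" where
  "q k = 4 * t + 3 - 2 * int k"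

fun val :: "vertex \<Rightarrow> int" where
  "val (Q k) = q k"
| "val (A j) = q (j + 2) + d j"
| "val (B j) = q (j + 2) - d j"
| "val G1 = 1"
| "val G2 = 2 * t"
| "val G3 = 2 * t + 2"
| "val G4 = 6 * t + 2"

definition verts :: "vertex set" where
  "verts = Q ` {..L + 2} \<union> A ` {..L} \<union> B ` {..L} \<union> {G1, G2, G3, G4}"

text \<open>The closing conditions are \<open>5 + 3 = 2 (3 + d_L)\<close> and \<open>7 - 3 = 2 (3 - d_L)\<close> modulo \<open>p\<close> at \<open>A L\<close> and \<open>B L\<close>, and at
  \<open>j = 0\<close> the six identities at \<open>Q 0\<close>, \<open>Q 1\<close> and \<open>G1, \<dots>, G4\<close>, which were found by a computer search
  and force \<open>d_0 = 12 t + 6\<close>.\<close>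

fun perm :: "vertex \<times> bool \<Rightarrow> vertex \<times> bool" where
  "perm (Q 0, True) = (G1, False)"
| "perm (Q 0, False) = (B 0, True)"
| "perm (Q (Suc 0), True) = (G2, True)"
| "perm (Q (Suc 0), False) = (G4, False)"
| "perm (Q (Suc (Suc j)), True) = (A j, True)"
| "perm (Q (Suc (Suc j)), False) = (B j, False)"
| "perm (A j, True) =
    (if j = L then (Q (L + 1), True) else if e j then (Q j, True) else (B (Suc j), True))"
| "perm (A j, False) =
    (if j = L then (Q (L + 2), False) else if e j then (A (Suc j), False) else (Q (j + 2), False))"
| "perm (B j, True) =
    (if j = L then (Q L, True) else if e j then (B (Suc j), True) else (Q j, True))"
| "perm (B j, False) =
    (if j = L then (Q (L + 2), True) else if e j then (Q (j + 2), False) else (A (Suc j), False))"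
| "perm (G1, True) = (G2, False)"
| "perm (G1, False) = (G3, False)"
| "perm (G2, True) = (G4, True)"
| "perm (G2, False) = (G3, True)"
| "perm (G3, True) = (G1, True)"
| "perm (G3, False) = (Q 0, False)"
| "perm (G4, True) = (Q 1, False)"
| "perm (G4, False) = (A 0, False)"

lemma finite_verts: "finite verts"
  by (simp add: verts_def)

lemma card_verts: "card verts \<le> 3 * L + 9"
proof -
  have "card verts \<le> card (Q ` {..L + 2}) + card (A ` {..L}) + card (B ` {..L}) + card {G1, G2, G3, G4}"
    unfolding verts_def by (intro order_trans[OF card_Un_le] add_mono order.refl)
  also have "\<dots> = 3 * L + 9"
    by (simp add: card_image inj_on_def)
  finally show ?thesis .
qed

lemma vertsI [simp]: "k \<le> L + 2 \<Longrightarrow> Q k \<in> verts" "j \<le> L \<Longrightarrow> A j \<in> verts" "j \<le> L \<Longrightarrow> B j \<in> verts"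
  "G1 \<in> verts" "G2 \<in> verts" "G3 \<in> verts" "G4 \<in> verts"
  by (auto simp: verts_def)

text \<open>Only \<open>A L\<close> and \<open>B L\<close> need reduction modulo \<open>p\<close>.
  At \<open>A j\<close> and \<open>B j\<close> with \<open>j < L\<close>, the \<open>- 2\<close> in
  the recursion for \<open>d\<close> compensates \<open>q j + q (j + 3) = 2 * q (j + 2) + 2\<close>
  or \<open>q (j + 2) + q (j + 3) = 2 * q (j + 2) - 2\<close>.\<close>

lemma perm_diff:
  assumes "u \<in> verts"
  shows "[signed val (perm (u, True)) - signed val (perm (u, False)) = 2 * val u] (mod int p)"
proof -
  have top: "[3 + d L + (3 + d L) = 5 + 3] (mod int p)" "[3 - d L + (3 - d L) = 7 - 3] (mod int p)"
    using cong_add[OF cong_add[OF cong_refl d_L] cong_add[OF cong_refl d_L], of 3 3]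
      cong_add[OF cong_diff[OF cong_refl d_L] cong_diff[OF cong_refl d_L], of 3 3] by simp_all
  have q_top: "q (Suc (Suc L)) = 3" "q (Suc L) = 5" "q L = 7"
    using L by (simp_all add: q_def)
  from assms consider k where "u = Q k" "k \<le> L + 2" | j where "u = A j" "j < L" | j where "u = B j" "j < L"
    | "u = A L" | "u = B L" | "u \<in> {G1, G2, G3, G4}"
    by (auto simp: verts_def le_less)
  then show ?thesis
  proof cases
    case (1 k)
    then show ?thesis
      by (cases "(u, True)" rule: perm.cases) (auto simp: signed_def q_def d_0 algebra_simps)
  next
    case (2 j)
    then have "signed val (perm (u, True)) - signed val (perm (u, False)) = 2 * val u"
      using d_Suc[of j] by (auto simp: signed_def q_def)
    then show ?thesis by simp
  next
    case (3 j)
    then have "signed val (perm (u, True)) - signed val (perm (u, False)) = 2 * val u"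
      using d_Suc[of j] by (auto simp: signed_def q_def)
    then show ?thesis by simp
  next
    case 4
    then show ?thesis using cong_sym[OF top(1)] by (simp add: signed_def q_top)
  next
    case 5
    then show ?thesis using cong_sym[OF top(2)] by (simp add: signed_def q_top)
  next
    case 6
    then show ?thesis by (auto simp: signed_def q_def d_0 algebra_simps)
  qed
qed

text \<open>Away from the two ends, \<open>Q (j + 2)\<close> is sent to \<open>(A j, True)\<close>
  and \<open>(B j, False)\<close>, while \<open>A j\<close> and \<open>B j\<close> are together sent
  to \<open>(A (Suc j), False)\<close>, \<open>(B (Suc j), True)\<close>, \<open>(Q j, True)\<close>
  and \<open>(Q (j + 2), False)\<close>, in an order that depends on \<open>e j\<close>.\<close>

lemma perm_surj: "perm ` (verts \<times> UNIV) = verts \<times> UNIV"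
proof
  have LL: "L \<ge> 4" using L t_ge by linarith
  show "perm ` (verts \<times> UNIV) \<subseteq> verts \<times> UNIV"
  proof
    fix y assume "y \<in> perm ` (verts \<times> UNIV)"
    then obtain u b where "u \<in> verts" "y = perm (u, b)" by auto
    then show "y \<in> verts \<times> UNIV"
      by (cases "(u, b)" rule: perm.cases) (auto simp: verts_def)
  qed
  have *: "\<exists>x \<in> verts \<times> UNIV. perm x = (u, b)" if "u \<in> verts" for u b
  proof -
    have ex: "\<exists>x \<in> verts \<times> UNIV. perm x = y" if "w \<in> verts" "perm (w, c) = y" for w c y
        using that by (intro bexI[of _ "(w, c)"]) auto
    from that consider k where "u = Q k" "k < L" | "u = Q L" | "u = Q (L + 1)" | "u = Q (L + 2)"
      | j where "u = A j" "j \<le> L" | j where "u = B j" "j \<le> L" | "u \<in> {G1, G2, G3, G4}"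
      unfolding verts_def by (auto simp: le_less less_Suc_eq)
    then show ?thesis
    proof cases
      case (1 k)
      show ?thesis
      proof (cases b)
        case True
        then show ?thesis using 1 by (intro ex[of "if e k then A k else B k" True]) auto
      next
        case False
        consider "k = 0" | "k = Suc 0" | j where "k = Suc (Suc j)" by (metis not0_implies_Suc)
        then show ?thesis
        proof cases
          case 3
          then show ?thesis using 1 False by (intro ex[of "if e j then B j else A j" False]) auto
        qed (use 1 False ex[of G3 False] ex[of G4 True] in auto)
      qed
    next
      case 2
      define j where "j = L - 2"
      then have "Suc (Suc j) = L" "j < L" using LL by simp_all
      then show ?thesis
        by (intro ex[of "if b then B L else if e j then B j else A j" b]) (simp_all add: 2)
    next
      case 3
      define j where "j = L - 1"
      then have "Suc j = L" "j < L" using LL by simp_all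
      then show ?thesis
        by (intro ex[of "if b then A L else if e j then B j else A j" b]) (simp_all add: 3)
    next
      case 4
      then show ?thesis by (intro ex[of "if b then B L else A L" False]) auto
    next
      case (5 j)
      show ?thesis
      proof (cases "b")
        case True
        then show ?thesis using 5 by (intro ex[of "Q (Suc (Suc j))" True]) auto
      next
        case False
        then show ?thesis using 5
          by (cases j; intro ex[of "if j = 0 then G4 else if e (j - 1) then A (j - 1) else B (j - 1)" False]) auto
      qed
    next
      case (6 j)
      show ?thesis
      proof (cases "b")
        case False
        then show ?thesis using 6 by (intro ex[of "Q (Suc (Suc j))" False]) auto
      next
        case True
        then show ?thesis using 6
          by (cases j; intro ex[of "if j = 0 then Q 0 else if e (j - 1) then B (j - 1) else A (j - 1)" "j \<noteq> 0"]) auto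
      qed
    next
      case 7
      then consider "u = G1" | "u = G2" | "u = G3" | "u = G4" by blast
      then show ?thesis
      proof cases
        case 1
        then show ?thesis by (intro ex[of "if b then G3 else Q 0" True]) auto
      next
        case 2
        then show ?thesis by (intro ex[of "if b then Q (Suc 0) else G1" True]) auto
      next
        case 3
        then show ?thesis by (intro ex[of "if b then G2 else G1" False]) auto
      next
        case 4
        then show ?thesis by (intro ex[of "if b then G2 else Q (Suc 0)" b]) auto
      qed
    qed
  qed
  show "verts \<times> UNIV \<subseteq> perm ` (verts \<times> UNIV)"
  proof
    fix y :: "vertex \<times> bool" assume "y \<in> verts \<times> UNIV"
    then obtain x where "x \<in> verts \<times> UNIV" "perm x = y" using *[of "fst y" "snd y"] by auto
    then show "y \<in> perm ` (verts \<times> UNIV)" by blast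
  qed
qed

section \<open>Distinctness modulo p\<close>

text \<open>The sign \<open>s\<close> treats \<open>A j\<close> (for \<open>s = 1\<close>) and
  \<open>B j\<close> (for \<open>s = -1\<close>) at once.\<close>

abbreviation w :: "nat \<Rightarrow> int \<Rightarrow> int" where
  "w j s \<equiv> q (j + 2) + s * d j"

lemma q_bounds:
  shows "j \<le> L \<Longrightarrow> 3 \<le> q (j + 2)" and "q (j + 2) \<le> 4 * t - 1"
  using L by (auto simp: q_def)

text \<open>Run the recursion backwards from \<open>d L\<close>: \<open>2 * d j\<close> is
  \<open>d (Suc j) + 2\<close> up to sign, so \<open>r\<close> becomes
  \<open>r + 2 ^ (i + 1)\<close> up to sign, which is again odd.\<close>

lemma d_residue:
  "i \<le> L \<Longrightarrow> \<exists>r. odd r \<and> \<bar>r\<bar> < 2 ^ (i + 1) \<and> [2 ^ i * d (L - i) = r] (mod int p)"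
proof (induction i)
  case 0
  then show ?case using d_L by (intro exI[of _ 1]) auto
next
  case (Suc i)
  then obtain r where r: "odd r" "\<bar>r\<bar> < 2 ^ (i + 1)" "[2 ^ i * d (L - i) = r] (mod int p)" by auto
  define \<sigma> :: int where "\<sigma> = (if e (L - Suc i) then 1 else -1)"
  have "L - i = Suc (L - Suc i)" using Suc.prems by simp
  then have "2 * d (L - Suc i) = \<sigma> * (d (L - i) + 2)"
    using d_Suc[of "L - Suc i"] Suc.prems by (simp add: \<sigma>_def)
  then have "2 ^ Suc i * d (L - Suc i) = 2 ^ i * (\<sigma> * (d (L - i) + 2))"
    by (simp flip: mult.assoc)
  also have "\<dots> = \<sigma> * (2 ^ i * d (L - i) + 2 ^ (i + 1))"
    by (simp add: algebra_simps)
  also have "[\<dots> = \<sigma> * (r + 2 ^ (i + 1))] (mod int p)"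
    by (intro cong_mult cong_add cong_refl r)
  finally have "[2 ^ Suc i * d (L - Suc i) = \<sigma> * (r + 2 ^ (i + 1))] (mod int p)" .
  moreover have "odd (\<sigma> * (r + 2 ^ (i + 1)))" using r(1) by (simp add: \<sigma>_def)
  moreover have "\<bar>\<sigma> * (r + 2 ^ (i + 1))\<bar> < 2 ^ (Suc i + 1)"
    using r(2) by (auto simp: \<sigma>_def abs_mult)
  ultimately show ?case by blast
qed

text \<open>The absolute value grows at least like \<open>x\<close> to \<open>2 * x - 2\<close> and
  at most like \<open>x\<close> to \<open>2 * x + 2\<close>. These maps have fixed points 2 and -2,
  and both bounds equal \<open>12 * t + 6\<close> at \<open>j = 0\<close>.\<close>

lemma d_bounds:
  "j \<le> L \<Longrightarrow> 2 ^ j * (12 * t + 4) + 2 \<le> \<bar>d j\<bar> \<and> \<bar>d j\<bar> \<le> 2 ^ j * (12 * t + 8) - 2"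
proof (induction j)
  case 0
  then show ?case using d_0 t_ge by simp
next
  case (Suc j)
  then have "2 * \<bar>d j\<bar> - 2 \<le> \<bar>d (Suc j)\<bar>" "\<bar>d (Suc j)\<bar> \<le> 2 * \<bar>d j\<bar> + 2"
    using d_Suc[of j] by auto
  moreover have "2 ^ Suc j * (12 * t + 4) = 2 * (2 ^ j * (12 * t + 4))"
    "2 ^ Suc j * (12 * t + 8) = 2 * (2 ^ j * (12 * t + 8))" by simp_all
  ultimately show ?case using Suc by linarith
qed

lemma d_ge: "j \<le> L \<Longrightarrow> 12 * t + 6 \<le> \<bar>d j\<bar>"
proof -
  assume "j \<le> L"
  moreover have "1 * (12 * t + 4) \<le> 2 ^ j * (12 * t + 4)"
    using t_ge by (intro mult_right_mono) auto
  ultimately show ?thesis using d_bounds[of j] \<open>j \<le> L\<close> by simp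
qed

lemma w_abs:
  assumes "\<bar>s\<bar> = 1" "j \<le> L"
  shows "\<bar>d j\<bar> - (4 * t - 1) \<le> \<bar>w j s\<bar>" "\<bar>w j s\<bar> \<le> \<bar>d j\<bar> + (4 * t - 1)"
proof -
  have "\<bar>s * d j\<bar> = \<bar>d j\<bar>" using assms by (simp add: abs_mult)
  then show "\<bar>d j\<bar> - (4 * t - 1) \<le> \<bar>w j s\<bar>" "\<bar>w j s\<bar> \<le> \<bar>d j\<bar> + (4 * t - 1)"
    using q_bounds[of j] assms(2) by linarith+
qed

lemma w_le: "\<bar>s\<bar> = 1 \<Longrightarrow> j \<le> L \<Longrightarrow> \<bar>w j s\<bar> \<le> 2 ^ j * (16 * t + 8)"
proof -
  assume *: "\<bar>s\<bar> = 1" "j \<le> L"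
  have "1 * (4 * t) \<le> 2 ^ j * (4 * t)"
    using t_ge by (intro mult_right_mono) auto
  moreover have "2 ^ j * (16 * t + 8) = 2 ^ j * (12 * t + 8) + 2 ^ j * (4 * t)"
    by (simp add: algebra_simps)
  ultimately show ?thesis using d_bounds[OF *(2)] w_abs(2)[OF *] by linarith
qed

text \<open>As integers, the values at \<open>A j\<close> and \<open>B j\<close> thus exceed in
  absolute value all the others, which are at most \<open>6 * t + 2\<close>.\<close>

lemma w_ge: "\<bar>s\<bar> = 1 \<Longrightarrow> j \<le> L \<Longrightarrow> 8 * t + 7 \<le> \<bar>w j s\<bar>"
  using d_ge[of j] w_abs(1)[of s j] by linarith

text \<open>Consecutive \<bar>d j\<bar> differ by more than \<open>8 * t - 2\<close>, twice the
  largest possible shift \<open>4 * t - 1\<close> by a midpoint.\<close>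

lemma w_strict:
  assumes "j < j'" "j' \<le> L" "\<bar>s\<bar> = 1" "\<bar>s'\<bar> = 1"
  shows "\<bar>w j s\<bar> < \<bar>w j' s'\<bar>"
proof -
  have step: "\<bar>d i\<bar> + (8 * t - 2) < \<bar>d (Suc i)\<bar>" if "i < L" for i
    using d_Suc[OF that] d_ge[of i] that t_ge by (auto split: if_splits)
  have mono: "\<bar>d j\<bar> + (8 * t - 2) < \<bar>d j'\<bar>"
    using assms(1,2)
  proof (induction j')
    case (Suc i)
    show ?case
    proof (cases "j = i")
      case True
      then show ?thesis using step[of i] Suc.prems by simp
    next
      case False
      then have "\<bar>d j\<bar> + (8 * t - 2) < \<bar>d i\<bar>" using Suc by simp
      then show ?thesis using step[of i] Suc.prems t_ge by linarith
    qed
  qed simp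
  then show ?thesis
    using w_abs(2)[of s j] w_abs(1)[of s' j'] assms by linarith
qed

section \<open>Non-congruence of the values, by parity or by size\<close>

lemma small_not_dvd: "z \<noteq> 0 \<Longrightarrow> \<bar>z\<bar> < int p \<Longrightarrow> \<not> int p dvd z"
  using zdvd_not_zless[of "\<bar>z\<bar>" "int p"] by simp

lemma w_residue:
  assumes "\<bar>s\<bar> = 1" "i \<le> L"
  obtains r where "odd r" "\<bar>r\<bar> < 2 ^ (i + 1)" "[2 ^ i * w (L - i) s = 2 ^ i * q (L - i + 2) + r] (mod int p)"
proof -
  obtain r where r: "odd r" "\<bar>r\<bar> < 2 ^ (i + 1)" "[2 ^ i * d (L - i) = r] (mod int p)"
    using d_residue assms(2) by blast
  have s: "s = 1 \<or> s = -1" using assms(1) by auto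
  have "[2 ^ i * q (L - i + 2) + s * (2 ^ i * d (L - i)) = 2 ^ i * q (L - i + 2) + s * r] (mod int p)"
    by (intro cong_add cong_mult cong_refl r)
  then have "[2 ^ i * w (L - i) s = 2 ^ i * q (L - i + 2) + s * r] (mod int p)"
    by (simp add: algebra_simps)
  moreover have "odd (s * r)" "\<bar>s * r\<bar> < 2 ^ (i + 1)"
    using r s by auto
  ultimately show thesis using that by blast
qed

text \<open>For \<open>i > 0\<close>, multiplying by \<open>2 ^ i\<close> makes the midpoint and
  \<open>V\<close> even, so the odd residue \<open>r\<close> decides. For \<open>i = 0\<close>
  parity says nothing, but \<open>w L s\<close> is congruent to \<open>3 + s\<close>, that is to 4
  or 2, the two excluded values of \<open>V\<close>.\<close>

lemma not_dvd_w_diff_of_small: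
  assumes s: "\<bar>s\<bar> = 1" and i: "i \<le> L" and V: "V \<noteq> 2" "V \<noteq> 4"
    and small: "2 ^ i * (\<bar>V\<bar> + 4 * t + 1) < int p"
  shows "\<not> int p dvd w (L - i) s - V"
proof (cases i)
  case 0
  have "[w L s = q (L + 2) + s * 1] (mod int p)"
    by (intro cong_add cong_mult cong_refl d_L)
  moreover have "q (L + 2) = 3" using L by (simp add: q_def)
  ultimately have "[w L s - V = 3 + s - V] (mod int p)"
    using cong_diff[OF _ cong_refl] by (metis mult.right_neutral)
  moreover have "\<not> int p dvd 3 + s - V"
    using s V small 0 t_ge by (intro small_not_dvd) auto
  ultimately show ?thesis using 0 by (simp add: cong_dvd_iff)
next
  case (Suc k)
  obtain r where r: "odd r" "\<bar>r\<bar> < 2 ^ (i + 1)" "[2 ^ i * w (L - i) s = 2 ^ i * q (L - i + 2) + r] (mod int p)"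
    using w_residue[OF s i] by blast
  let ?z = "2 ^ i * q (L - i + 2) + r - 2 ^ i * V"
  have "[2 ^ i * (w (L - i) s - V) = ?z] (mod int p)"
    using cong_diff[OF r(3) cong_refl] by (simp add: right_diff_distrib)
  moreover have "\<not> int p dvd ?z"
  proof (rule small_not_dvd)
    have "odd ?z" using r(1) Suc by simp
    then show "?z \<noteq> 0" by (metis even_zero)
    have "\<bar>?z\<bar> \<le> \<bar>2 ^ i * (q (L - i + 2) - V)\<bar> + \<bar>r\<bar>" by (simp add: right_diff_distrib)
    also have "\<dots> < 2 ^ i * \<bar>q (L - i + 2) - V\<bar> + 2 * 2 ^ i" using r(2) by (simp add: abs_mult)
    also have "\<dots> = 2 ^ i * (\<bar>q (L - i + 2) - V\<bar> + 2)" by (simp add: algebra_simps)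
    also have "\<dots> \<le> 2 ^ i * (\<bar>V\<bar> + 4 * t + 1)"
      using q_bounds[of "L - i"] by (intro mult_left_mono) auto
    finally show "\<bar>?z\<bar> < int p" using small by simp
  qed
  ultimately show ?thesis by (metis cong_dvd_iff dvd_mult)
qed

text \<open>This serves the case where the parity argument fails: since \<open>2 ^ L\<close> is at
  most \<open>8 * p\<close>, a large \<open>2 ^ i\<close> leaves only a small index
  \<open>L - i\<close>.\<close>

lemma pow_le_of_large:
  assumes "i \<le> L" "int p \<le> 2 ^ i * c"
  shows "2 ^ (L - i) \<le> 8 * c"
proof -
  have p: "int p > 0" using odd_p by (cases p) auto
  have c: "c > 0"
  proof (rule ccontr)
    assume "\<not> c > 0"
    then have "2 ^ i * c \<le> 0" by (intro mult_nonneg_nonpos) auto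
    then show False using assms p by linarith
  qed
  have "2 ^ (L - i) * int p \<le> 2 ^ (L - i) * (2 ^ i * c)" using assms by (intro mult_left_mono) auto
  also have "\<dots> = 2 ^ L * c" using assms by (simp flip: mult.assoc power_add)
  also have "\<dots> \<le> 8 * int p * c" using c L_le by (intro mult_right_mono) auto
  finally have "2 ^ (L - i) * int p \<le> (8 * c) * int p" by (simp add: algebra_simps)
  then show ?thesis using p by simp
qed

lemma w_le_of_large:
  assumes "i \<le> L" "int p \<le> 2 ^ i * c" "\<bar>s\<bar> = 1"
  shows "\<bar>w (L - i) s\<bar> \<le> 8 * c * (16 * t + 8)"
proof -
  have "\<bar>w (L - i) s\<bar> \<le> 2 ^ (L - i) * (16 * t + 8)" using assms by (intro w_le) auto
  also have "\<dots> \<le> 8 * c * (16 * t + 8)"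
    using pow_le_of_large[OF assms(1,2)] t_ge by (intro mult_right_mono) auto
  finally show ?thesis .
qed

lemma poly_bound_less: "0 \<le> c \<Longrightarrow> c \<le> 8 * (8 * t + 2) * (16 * t + 8) + 4 * t + 1 \<Longrightarrow> 2 * (8 * c * (16 * t + 8)) < int p"
proof -
  assume "0 \<le> c" and c: "c \<le> 8 * (8 * t + 2) * (16 * t + 8) + 4 * t + 1"
  have "2 * (8 * c * (16 * t + 8)) = 16 * c * (16 * t + 8)" by simp
  also have "\<dots> \<le> 16 * (8 * (8 * t + 2) * (16 * t + 8) + 4 * t + 1) * (16 * t + 8)"
    using c t_ge by (intro mult_right_mono mult_left_mono) auto
  finally show ?thesis using p_large by linarith
qed

lemma linear_le_poly: "c \<le> 16 * t + 8 \<Longrightarrow> c \<le> 8 * (8 * t + 2) * (16 * t + 8) + 4 * t + 1"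
proof -
  assume c: "c \<le> 16 * t + 8"
  define X where "X = 8 * (8 * t + 2) * (16 * t + 8)"
  have "1 * (16 * t + 8) \<le> X"
    unfolding X_def using t_ge by (intro mult_right_mono) auto
  then have "c \<le> X + 4 * t + 1" using c t_ge by simp
  then show ?thesis unfolding X_def .
qed

lemma not_dvd_w_diff_const:
  assumes s: "\<bar>s\<bar> = 1" and j: "j \<le> L" and V: "V \<noteq> 2" "V \<noteq> 4" "\<bar>V\<bar> \<le> 6 * t + 2"
  shows "\<not> int p dvd w j s - V"
proof -
  define i where "i = L - j"
  have i: "i \<le> L" "L - i = j" using j by (auto simp: i_def)
  show ?thesis
  proof (cases "2 ^ i * (\<bar>V\<bar> + 4 * t + 1) < int p")
    case True
    then show ?thesis using not_dvd_w_diff_of_small[OF s i(1)] V i(2) by simp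
  next
    case False
    let ?c = "\<bar>V\<bar> + 4 * t + 1"
    have "\<bar>w j s\<bar> \<le> 8 * ?c * (16 * t + 8)"
      using w_le_of_large[OF i(1) _ s, of ?c] False i(2) by simp
    moreover have "2 * (8 * ?c * (16 * t + 8)) < int p"
      using V(3) t_ge by (intro poly_bound_less linear_le_poly) auto
    moreover have "8 * t + 7 \<le> \<bar>w j s\<bar>" using w_ge s j by simp
    ultimately show ?thesis using V(3) by (intro small_not_dvd) linarith+
  qed
qed

text \<open>Multiply by the larger power \<open>2 ^ i\<close>: it leaves the odd residue
  \<open>r\<close> from \<open>w j s\<close>, but only an even multiple of \<open>r'\<close> from
  \<open>w j' s'\<close>, since \<open>i' < i\<close>. The factor \<open>k\<close> covers
  differences and sums.\<close>

lemma not_dvd_w_diff: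
  assumes s: "\<bar>s\<bar> = 1" "\<bar>s'\<bar> = 1" and k: "\<bar>k\<bar> = 1" and jj: "j < j'" "j' \<le> L"
  shows "\<not> int p dvd w j s - k * w j' s'"
proof -
  define i where "i = L - j"
  define i' where "i' = L - j'"
  have i: "i \<le> L" "L - i = j" "i' \<le> L" "L - i' = j'" "i' < i" using jj by (auto simp: i_def i'_def)
  have k': "k = 1 \<or> k = -1" using k by auto
  show ?thesis
  proof (cases "2 ^ i * (8 * t + 2) < int p")
    case True
    obtain r where r: "odd r" "\<bar>r\<bar> < 2 ^ (i + 1)" "[2 ^ i * w j s = 2 ^ i * q (j + 2) + r] (mod int p)"
      using w_residue[OF s(1) i(1)] i(2) by metis
    obtain r' where r': "odd r'" "\<bar>r'\<bar> < 2 ^ (i' + 1)" "[2 ^ i' * w j' s' = 2 ^ i' * q (j' + 2) + r'] (mod int p)"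
      using w_residue[OF s(2) i(3)] i(4) by metis
    have pow: "(2::int) ^ i = 2 ^ (i - i') * 2 ^ i'" using i(5) by (simp flip: power_add)
    let ?z = "2 ^ i * q (j + 2) + r - k * (2 ^ i * q (j' + 2) + 2 ^ (i - i') * r')"
    have "[2 ^ i * w j s - k * (2 ^ (i - i') * (2 ^ i' * w j' s'))
        = 2 ^ i * q (j + 2) + r - k * (2 ^ (i - i') * (2 ^ i' * q (j' + 2) + r'))] (mod int p)"
      by (intro cong_diff cong_mult cong_refl r r')
    then have "[2 ^ i * (w j s - k * w j' s') = ?z] (mod int p)"
      by (simp add: pow algebra_simps)
    moreover have "\<not> int p dvd ?z"
    proof (rule small_not_dvd)
      have "odd ?z" using r(1) i(5) k' by auto
      then show "?z \<noteq> 0" by (metis even_zero)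
      have "\<bar>2 ^ (i - i') * r'\<bar> < 2 ^ (i - i') * 2 ^ (i' + 1)"
        using r'(2) by (simp add: abs_mult)
      also have "\<dots> = 2 ^ (i + 1)" by (simp add: pow)
      finally have c_less: "\<bar>2 ^ (i - i') * r'\<bar> < 2 ^ (i + 1)" .
      define a b c where "a = 2 ^ i * q (j + 2)" and "b = 2 ^ i * q (j' + 2)"
        and "c = 2 ^ (i - i') * r'"
      define X Y :: int where "X = 2 ^ i * (4 * t - 1)" and "Y = 2 ^ (i + 1)"
      have "a \<le> X" "b \<le> X"
        unfolding a_def b_def X_def using q_bounds(2) jj by (intro mult_left_mono; simp)+
      moreover have "0 \<le> a" "0 \<le> b"
        using q_bounds(1)[of j] q_bounds(1)[of j'] jj by (simp_all add: a_def b_def)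
      moreover have "2 * X + 2 * Y = 2 ^ i * (8 * t + 2)"
        by (simp add: X_def Y_def algebra_simps)
      then have "2 * X + 2 * Y < int p" using True by simp
      moreover have "\<bar>r\<bar> < Y" "\<bar>c\<bar> < Y" using r(2) c_less by (simp_all add: Y_def c_def)
      ultimately have "\<bar>a + r - (b + c)\<bar> < int p" "\<bar>a + r + (b + c)\<bar> < int p"
        by linarith+
      then have "\<bar>a + r - k * (b + c)\<bar> < int p"
        using k' by auto
      then show "\<bar>?z\<bar> < int p" by (simp only: a_def b_def c_def)
    qed
    ultimately show ?thesis by (metis cong_dvd_iff dvd_mult)
  next
    case False
    \<comment> \<open>Now \<open>w j s\<close> is bounded by a polynomial in \<open>t\<close>, so it
      can take the role of the constant \<open>V\<close> against \<open>w j' s'\<close>. If parity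
      fails again, both are integers far below \<open>p\<close> and \<open>w_strict\<close>
      separates them.\<close>
    let ?V = "k * w j s"
    have absV: "\<bar>?V\<bar> = \<bar>w j s\<bar>" using k by (simp add: abs_mult)
    have Vle: "\<bar>?V\<bar> \<le> 8 * (8 * t + 2) * (16 * t + 8)"
      using w_le_of_large[OF i(1) _ s(1), of "8 * t + 2"] False i(2) absV by simp
    have Vge: "8 * t + 7 \<le> \<bar>?V\<bar>" using w_ge[OF s(1)] jj absV by simp
    have "\<not> int p dvd w j' s' - ?V"
    proof (cases "2 ^ i' * (\<bar>?V\<bar> + 4 * t + 1) < int p")
      case True
      then show ?thesis using not_dvd_w_diff_of_small[OF s(2) i(3), of ?V] Vge t_ge i(4) by force
    next
      case F: False
      let ?c = "\<bar>?V\<bar> + 4 * t + 1"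
      have "\<bar>w j' s'\<bar> \<le> 8 * ?c * (16 * t + 8)"
        using w_le_of_large[OF i(3) _ s(2), of ?c] F i(4) by simp
      moreover have "2 * (8 * ?c * (16 * t + 8)) < int p"
        using Vle t_ge by (intro poly_bound_less) auto
      moreover have "\<bar>?V\<bar> < \<bar>w j' s'\<bar>" using w_strict[OF jj s] absV by simp
      ultimately show ?thesis by (intro small_not_dvd) linarith+
    qed
    moreover have "w j s - k * w j' s' = - k * (w j' s' - ?V)"
      using k' by auto
    moreover have "int p dvd - k * x \<longleftrightarrow> int p dvd x" for x using k' by auto
    ultimately show ?thesis by metis
  qed
qed

text \<open>This separates \<open>A j\<close> from \<open>B j\<close>, whose values differ by
  \<open>2 * d j\<close>.\<close>

lemma not_dvd_d:
  assumes j: "j \<le> L"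
  shows "\<not> int p dvd d j"
proof -
  define i where "i = L - j"
  have i: "i \<le> L" "L - i = j" using j by (auto simp: i_def)
  show ?thesis
  proof (cases "2 ^ i * 2 < int p")
    case True
    obtain r where r: "odd r" "\<bar>r\<bar> < 2 ^ (i + 1)" "[2 ^ i * d j = r] (mod int p)"
      using d_residue[OF i(1)] i(2) by auto
    then have "\<not> int p dvd r" using True by (intro small_not_dvd) auto
    then show ?thesis using r(3) by (metis cong_dvd_iff dvd_mult)
  next
    case False
    then have "2 ^ j \<le> (16::int)" using pow_le_of_large[OF i(1), of 2] i(2) by simp
    then have "2 ^ j * (12 * t + 8) \<le> 16 * (12 * t + 8)" using t_ge by (intro mult_right_mono) auto
    then have "\<bar>d j\<bar> \<le> 16 * (12 * t + 8)" using d_bounds[OF j] by linarith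
    also have "\<dots> \<le> 2 * (8 * 1 * (16 * t + 8))" using t_ge by simp
    also have "\<dots> < int p" using t_ge by (intro poly_bound_less linear_le_poly) auto
    finally show ?thesis using d_ge[OF j] t_ge by (intro small_not_dvd) auto
  qed
qed

text \<open>The case \<open>k = -1\<close> excludes coincidences between a value and a
  negative.\<close>

lemma val_inj:
  assumes u: "u \<in> verts" and u': "u' \<in> verts" and k: "\<bar>k\<bar> = 1" and dvd: "int p dvd val u - k * val u'"
  shows "u = u' \<and> k = 1"
proof -
  have p12: "12 * t + 4 < int p"
    using poly_bound_less[of 1] linear_le_poly[of 1] t_ge by simp
  have k': "k = 1 \<or> k = -1" using k by auto
  \<comment> \<open>The values 2 and 4 are barred because they are the residues of
    \<open>B L\<close> and \<open>A L\<close>.\<close>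
  define small where "small x \<longleftrightarrow> 1 \<le> val x \<and> val x \<le> 6 * t + 2 \<and> val x \<noteq> 2 \<and> val x \<noteq> 4" for x
  have cases: "(x \<in> Q ` {..L + 2} \<union> {G1, G2, G3, G4} \<and> small x) \<or>
      (\<exists>j s. j \<le> L \<and> \<bar>s\<bar> = 1 \<and> val x = w j s \<and> x = (if s = 1 then A j else B j))" if x: "x \<in> verts" for x
  proof -
    consider k where "x = Q k" "k \<le> L + 2" | j where "x = A j" "j \<le> L" | j where "x = B j" "j \<le> L"
      | "x \<in> {G1, G2, G3, G4}"
      using x by (auto simp: verts_def)
    then show ?thesis
    proof cases
      case 1
      then have "int k \<le> 2 * t" using L by linarith
      then have "3 \<le> q k \<and> q k \<le> 6 * t + 2 \<and> odd (q k)" using t_ge by (auto simp: q_def)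
      then have "small x" using 1 by (auto simp: small_def)
      then show ?thesis using 1 by auto
    next
      case 2
      then show ?thesis by (intro disjI2 exI[of _ j] exI[of _ 1]) auto
    next
      case 3
      then show ?thesis by (intro disjI2 exI[of _ j] exI[of _ "-1"]) auto
    next
      case 4
      then show ?thesis using t_ge by (auto simp: small_def)
    qed
  qed
  have no: False
    if "int p dvd w j s - k * val x" "j \<le> L" "\<bar>s\<bar> = 1" "\<bar>k\<bar> = 1" "small x" for j s k x
  proof -
    have "k = 1 \<or> k = -1" using that by auto
    then show False using not_dvd_w_diff_const[OF that(3,2), of "k * val x"] that by (auto simp: small_def)
  qed
  have swap: "int p dvd y - k * x \<longleftrightarrow> int p dvd x - k * y" for x y
    using k' dvd_minus_iff[of "int p" "x - y"] by (auto simp: algebra_simps)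
  show ?thesis
    using cases[OF u] cases[OF u']
  proof (elim disjE exE conjE)
    assume a: "u \<in> Q ` {..L + 2} \<union> {G1, G2, G3, G4}" "u' \<in> Q ` {..L + 2} \<union> {G1, G2, G3, G4}"
      and s: "small u" "small u'"
    have "\<bar>val u - k * val u'\<bar> < int p"
      using s k' p12 by (auto simp: small_def)
    then have "val u - k * val u' = 0"
      using small_not_dvd dvd by blast
    then have k1: "k = 1" and eq: "val u = val u'" using k' s by (auto simp: small_def)
    have "odd (q i) \<and> q i \<noteq> 1" if "i \<le> L + 2" for i
      using that L by (auto simp: q_def)
    then have Q: "q i \<noteq> 1" "q i \<noteq> 2 * t" "q i \<noteq> 2 * t + 2" "q i \<noteq> 6 * t + 2" if "i \<le> L + 2" for i
      using that by (metis dvd_triv_left even_add even_mult_iff even_numeral)+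
    have q_inj: "q i = q i' \<longleftrightarrow> i = i'" for i i' by (simp add: q_def)
    have "u = u'"
      using a eq t_ge by (elim UnE imageE insertE emptyE) (simp_all add: q_inj Q Q[symmetric])
    with k1 show ?thesis by simp
  next
    fix j s assume "j \<le> L" "\<bar>s\<bar> = 1" "val u = w j s" "small u'"
    then show ?thesis using no[of j s k u'] dvd k by auto
  next
    fix j s assume "j \<le> L" "\<bar>s\<bar> = 1" "val u' = w j s" "small u"
    then show ?thesis using no[of j s k u] dvd k swap[of "val u" "val u'"] by auto
  next
    fix j s j' s'
    assume j: "j \<le> L" "j' \<le> L" and s: "\<bar>s\<bar> = 1" "\<bar>s'\<bar> = 1"
      and v: "val u = w j s" "val u' = w j' s'"
      and uu: "u = (if s = 1 then A j else B j)" "u' = (if s' = 1 then A j' else B j')"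
    have "j = j'"
    proof (rule ccontr)
      assume "j \<noteq> j'"
      then consider "j < j'" | "j' < j" by linarith
      then show False
      proof cases
        case 1
        then show False using not_dvd_w_diff[OF s k 1 j(2)] dvd v by simp
      next
        case 2
        then show False using not_dvd_w_diff[OF s(2,1) k 2 j(1)] dvd v swap[of "val u" "val u'"] by simp
      qed
    qed
    have half: "int p dvd x" if "int p dvd 2 * x" for x
    proof -
      have "coprime (int p) 2" using odd_p by (simp add: coprime_commute)
      then show ?thesis using that coprime_dvd_mult_right_iff by blast
    qed
    have nq: "\<not> int p dvd q (j + 2)"
      using q_bounds(1)[OF j(1)] q_bounds(2)[of j] p12 t_ge by (intro small_not_dvd) auto
    have nd: "\<not> int p dvd d j" using not_dvd_d[OF j(1)] .
    have nw: "\<not> int p dvd w j s"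
      using not_dvd_w_diff_const[OF s(1) j(1), of 0] t_ge by simp
    have s2: "s = 1 \<or> s = -1" "s' = 1 \<or> s' = -1" using s by auto
    show ?thesis
    proof (cases "s = s'")
      case True
      have "k \<noteq> -1"
      proof
        assume "k = -1"
        then have "int p dvd 2 * w j s" using dvd v True \<open>j = j'\<close> by (simp add: algebra_simps)
        then show False using nw half by blast
      qed
      then show ?thesis using k' uu True \<open>j = j'\<close> by auto
    next
      case False
      then have "s' = - s" using s2 by auto
      then have v': "val u' = q (j + 2) - s * d j" using v \<open>j = j'\<close> by simp
      \<comment> \<open>For \<open>k = 1\<close> only \<open>d j\<close> survives, for
        \<open>k = -1\<close> only the midpoint.\<close>
      have "val u - k * val u' = (1 - k) * q (j + 2) + (1 + k) * (s * d j)"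
        unfolding v(1) v' by (simp add: algebra_simps)
      then have "int p dvd 2 * q (j + 2) \<or> int p dvd 2 * (s * d j)"
        using dvd k' by auto
      then have "int p dvd q (j + 2) \<or> int p dvd d j"
        using half[of "q (j + 2)"] half[of "s * d j"] s2 by auto
      then show ?thesis using nq nd by blast
    qed
  qed
qed

lemma signed_inj: "inj_on (\<lambda>x. signed val x mod int p) (verts \<times> UNIV)"
proof (rule inj_onI)
  fix x y assume "x \<in> verts \<times> (UNIV :: bool set)" "y \<in> verts \<times> (UNIV :: bool set)"
    and eq: "signed val x mod int p = signed val y mod int p"
  then obtain u b u' b' where x: "x = (u, b)" "y = (u', b')" "u \<in> verts" "u' \<in> verts" by auto
  define k :: int where "k = (if b = b' then 1 else -1)"
  have dvd: "int p dvd signed val x - signed val y" using eq by (simp add: mod_eq_dvd_iff)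
  have "signed val x - signed val y = (if b then 1 else -1) * (val u - k * val u')"
    by (auto simp: x signed_def k_def)
  then have "int p dvd val u - k * val u'" using dvd by (cases b) (simp_all add: dvd_diff_commute)
  moreover have "\<bar>k\<bar> = 1" by (simp add: k_def)
  ultimately have "u = u' \<and> k = 1" using val_inj x(3,4) by blast
  then show "x = y" using x by (auto simp: k_def split: if_splits)
qed

lemma transversal_exists:
  "\<exists>T. is_transversal p (cyclic_square p) T \<and> T \<noteq> main_diagonal p \<and>
       card {t \<in> T. fst t \<noteq> fst (snd t)} \<le> 6 * L + 18"
proof -
  obtain T where "is_transversal p (cyclic_square p) T" "T \<noteq> main_diagonal p"
    "card {t \<in> T. fst t \<noteq> fst (snd t)} \<le> 2 * card verts"
    using transversal_of_signed_permutation[OF odd_p finite_verts signed_inj perm_surj perm_diff, of "(G1, True)"]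
    by auto
  then show ?thesis using card_verts by (intro exI[of _ T]) auto
qed

end

section \<open>Choosing the signs\<close>

text \<open>Up to sign, the reachable values of \<open>d L\<close> are
  \<open>2 ^ L * (a - 2) + 2 + 4 * n\<close> for \<open>n\<close> with \<open>L\<close> binary
  digits. Even \<open>n = 2 * m\<close> suffice: 8 is invertible modulo \<open>p\<close>, and
  \<open>m\<close> may be any residue because \<open>p\<close> is at most
  \<open>2 ^ (L - 1)\<close>.\<close>

lemma chain_digits:
  fixes a :: int and p L :: nat
  assumes "odd p" "L \<ge> 1" "int p \<le> 2 ^ (L - 1)"
  shows "\<exists>d e. d 0 = a \<and> (\<forall>j<L. d (Suc j) = (if e j then 2 * d j - 2 else - 2 * d j - 2)) \<and> [d L = 1] (mod int p)"
proof -
  have p0: "int p > 0" using assms(1) by (cases p) auto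
  have "coprime ((2::int) ^ 3) (int p)" using assms(1) by (subst coprime_power_left_iff) simp
  then obtain x where x: "[8 * x = 1] (mod int p)"
    using cong_solve_coprime_int[of 8 "int p"] by auto
  define c where "c = - 1 - 2 ^ L * (a - 2)"
  define m where "m = (x * c) mod int p"
  have "[8 * m = 8 * (x * c)] (mod int p)"
    unfolding m_def by (intro cong_mult cong_refl) (simp add: cong_def)
  also have "[8 * (x * c) = 1 * c] (mod int p)"
    using cong_mult[OF x cong_refl, of c] by (simp add: mult.assoc)
  finally have "[2 ^ L * (a - 2) + 2 + 8 * m = 2 ^ L * (a - 2) + 2 + c] (mod int p)"
    by (intro cong_add cong_refl) simp
  then have m_cong: "[2 ^ L * (a - 2) + 2 + 8 * m = 1] (mod int p)" by (simp add: c_def)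
  have m_bounds: "0 \<le> m" "m < 2 ^ (L - 1)"
    unfolding m_def using p0 less_le_trans[OF pos_mod_bound[OF p0] assms(3)] by simp_all
  define n where "n = 2 * m"
  have n_bounds: "0 \<le> n" "n < 2 ^ L"
    using m_bounds assms(2) by (simp_all add: n_def power_eq_if)
  \<comment> \<open>Up to sign \<open>d j\<close> is \<open>D j\<close>, which satisfies \<open>D (Suc j) = 2 * D j - 2\<close> or \<open>2 * D j + 2\<close> according to the
    binary digits of \<open>n\<close>; the last digit is \<open>0\<close>, so that the sign of \<open>d L\<close> is positive.\<close>
  define D where "D j = 2 ^ j * (a - 2) + 2 + 4 * (n div 2 ^ (L - j))" for j
  define b where "b j \<longleftrightarrow> odd (n div 2 ^ (L - Suc j))" for j
  define \<sigma> :: "nat \<Rightarrow> int" where "\<sigma> j = (case j of 0 \<Rightarrow> 1 | Suc i \<Rightarrow> if b i then - 1 else 1)" for j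
  define d where "d j = \<sigma> j * D j" for j
  \<comment> \<open>So \<open>e j\<close> holds exactly when
    \<open>\<sigma> j = \<sigma> (Suc j)\<close>.\<close>
  define e where "e j \<longleftrightarrow> (\<sigma> j = 1) \<noteq> b j" for j
  have D_Suc: "D (Suc j) = 2 * D j - 2 + (if b j then 4 else 0)" if "j < L" for j
  proof -
    let ?N = "n div 2 ^ (L - Suc j)"
    have "L - j = Suc (L - Suc j)" using that by simp
    then have "n div 2 ^ (L - j) = ?N div 2"
      by (simp only: power_Suc2 zdiv_zmult2_eq zero_le_numeral)
    moreover have "?N = 2 * (?N div 2) + (if b j then 1 else 0)"
      unfolding b_def by (simp add: odd_two_times_div_two_succ)
    moreover have "D (Suc j) = 2 * (2 ^ j * (a - 2)) + 2 + 4 * ?N" "D j = 2 ^ j * (a - 2) + 2 + 4 * (n div 2 ^ (L - j))"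
      by (simp_all add: D_def)
    moreover have "(if b j then 4 else 0) = 4 * (if b j then 1 else 0 :: int)" by simp
    ultimately show ?thesis by linarith
  qed
  have "d 0 = a"
    using n_bounds by (simp add: d_def \<sigma>_def D_def)
  moreover have "d (Suc j) = (if e j then 2 * d j - 2 else - 2 * d j - 2)" if "j < L" for j
  proof -
    have "\<sigma> j = 1 \<or> \<sigma> j = - 1" by (cases j) (auto simp: \<sigma>_def)
    then show ?thesis
      by (auto simp: d_def e_def D_Suc[OF that] \<sigma>_def[of "Suc j"])
  qed
  moreover have "[d L = 1] (mod int p)"
  proof -
    obtain i where "L = Suc i" using assms(2) by (cases L) auto
    then have "\<not> b i" by (simp add: b_def n_def)
    then have "d L = 2 ^ L * (a - 2) + 2 + 8 * m"
      using \<open>L = Suc i\<close> by (simp add: d_def \<sigma>_def D_def n_def)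
    then show ?thesis using m_cong by simp
  qed
  ultimately show ?thesis by blast
qed

section \<open>Small primes, growth estimates and the final bound\<close>

lemma transversal_shift:
  assumes "odd p" "p \<ge> 3"
  shows "\<exists>T. is_transversal p (cyclic_square p) T \<and> T \<noteq> main_diagonal p \<and>
       card {t \<in> T. fst t \<noteq> fst (snd t)} \<le> p"
proof -
  \<comment> \<open>The cells \<open>(x, x + 1)\<close> form a transversal off the diagonal, good
    enough for boundedly many primes.\<close>
  define c where "c x = (x + 1) mod p" for x
  define s where "s x = (2 * x + 1) mod p" for x
  have bij: "bij_betw f {..<p} {..<p}" if "inj_on f {..<p}" "f ` {..<p} \<subseteq> {..<p}" for f :: "nat \<Rightarrow> nat"
    using that by (simp add: bij_betw_def endo_inj_surj)
  have "bij_betw c {..<p} {..<p}"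
  proof (rule bij)
    show "inj_on c {..<p}"
    proof (rule inj_onI)
      fix x y assume "x \<in> {..<p}" "y \<in> {..<p}" "c x = c y"
      then have "[x + 1 = y + 1] (mod p)" by (simp add: c_def cong_def)
      then have "[x = y] (mod p)" by (simp only: cong_add_rcancel_nat)
      then show "x = y" using \<open>x \<in> {..<p}\<close> \<open>y \<in> {..<p}\<close> by (simp add: cong_def)
    qed
  qed (use assms in \<open>auto simp: c_def\<close>)
  moreover have "bij_betw s {..<p} {..<p}"
  proof (rule bij)
    show "inj_on s {..<p}"
    proof (rule inj_onI)
      fix x y assume "x \<in> {..<p}" "y \<in> {..<p}" "s x = s y"
      then have "[2 * x + 1 = 2 * y + 1] (mod p)" by (simp add: s_def cong_def)
      then have "[2 * x = 2 * y] (mod p)" by (simp only: cong_add_rcancel_nat)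
      moreover have "coprime 2 p" using assms by simp
      ultimately have "[x = y] (mod p)" using cong_mult_lcancel_nat by blast
      then show "x = y" using \<open>x \<in> {..<p}\<close> \<open>y \<in> {..<p}\<close> by (simp add: cong_def)
    qed
  qed (use assms in \<open>auto simp: s_def\<close>)
  moreover have "(id x + c x) mod p = s x" for x
    by (simp add: c_def s_def mod_simps mult_2 add.assoc)
  ultimately have T: "is_transversal p (cyclic_square p) ((\<lambda>x. (id x, c x, s x)) ` {..<p})" (is "is_transversal p _ ?T")
    by (intro is_transversal_image bij_betw_id) auto
  have "(0, 1, 1) \<in> ?T" using assms by (auto simp: c_def s_def image_iff intro!: bexI[of _ 0])
  moreover have "(0, 1, 1) \<notin> main_diagonal p" by (auto simp: main_diagonal_def)
  ultimately have "?T \<noteq> main_diagonal p" by blast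
  moreover have "card {t \<in> ?T. fst t \<noteq> fst (snd t)} \<le> card ?T"
    by (intro card_mono) auto
  moreover have "card ?T \<le> p" using card_image_le[of "{..<p}"] by simp
  ultimately show ?thesis using T by (intro exI[of _ ?T]) auto
qed

text \<open>The constant is 512 * 1300 * 17, from the estimates in \<open>poly_less_power4\<close>,
  rounded up.\<close>

lemma cube_less_power4:
  assumes "t \<ge> 20"
  shows "11400000 * t ^ 3 < (4::nat) ^ t"
  using assms
proof (induction t rule: nat_induct_at_least)
  case (Suc t)
  have "20 * t \<le> t * t" "20 * (t * t) \<le> t * (t * t)"
    using Suc.hyps by (intro mult_right_mono; simp)+
  moreover have "(Suc t) ^ 3 = t * (t * t) + 3 * (t * t) + 3 * t + 1"
    by (simp add: power3_eq_cube algebra_simps)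
  moreover have "t ^ 3 = t * (t * t)" by (simp add: power3_eq_cube)
  ultimately have "(Suc t) ^ 3 \<le> 4 * t ^ 3" using Suc.hyps by linarith
  then show ?case using Suc.IH by simp
qed simp

text \<open>The factor 32 matches \<open>4 ^ t \<le> 32 * p\<close> and so yields
  \<open>p_large\<close>.\<close>

lemma poly_less_power4:
  assumes "t \<ge> (20 :: nat)"
  shows "32 * (16 * (8 * (8 * int t + 2) * (16 * int t + 8) + 4 * int t + 1) * (16 * int t + 8)) < 4 ^ t"
proof -
  define x where "x = int t"
  have x: "x \<ge> 20" using assms by (simp add: x_def)
  have "(8 * x + 2) * (16 * x + 8) \<le> (9 * x) * (17 * x)"
    using x by (intro mult_mono) auto
  moreover have "20 * x \<le> x * x" using x by (intro mult_right_mono) auto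
  ultimately have "8 * ((8 * x + 2) * (16 * x + 8)) + 4 * x + 1 \<le> 1300 * (x * x)" using x by linarith
  then have "(8 * ((8 * x + 2) * (16 * x + 8)) + 4 * x + 1) * (16 * x + 8) \<le> (1300 * (x * x)) * (17 * x)"
    using x by (intro mult_mono) auto
  moreover have "32 * (16 * (8 * (8 * x + 2) * (16 * x + 8) + 4 * x + 1) * (16 * x + 8)) =
      512 * ((8 * ((8 * x + 2) * (16 * x + 8)) + 4 * x + 1) * (16 * x + 8))"
    by (simp add: algebra_simps)
  moreover have "512 * ((1300 * (x * x)) * (17 * x)) \<le> 11400000 * x ^ 3"
    using x by (simp add: power3_eq_cube)
  ultimately have "32 * (16 * (8 * (8 * x + 2) * (16 * x + 8) + 4 * x + 1) * (16 * x + 8)) \<le> 11400000 * x ^ 3"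
    by linarith
  also have "\<dots> = int (11400000 * t ^ 3)" by (simp add: x_def)
  also have "\<dots> < int (4 ^ t)" using cube_less_power4[OF assms] by (simp only: of_nat_less_iff)
  finally show ?thesis by (simp add: x_def)
qed

lemma transversal_large:
  assumes "odd p" "p > 4 ^ 20"
  shows "\<exists>T. is_transversal p (cyclic_square p) T \<and> T \<noteq> main_diagonal p \<and>
           real (card {t \<in> T. fst t \<noteq> fst (snd t)}) \<le> 26 * ln (real p)"
proof -
  \<comment> \<open>This puts \<open>4 ^ t\<close> between \<open>8 * p\<close> and
    \<open>32 * p\<close>, hence \<open>2 ^ L\<close> between \<open>2 * p\<close> and
    \<open>8 * p\<close>: enough digits for \<open>chain_digits\<close>, yet within the bound
    \<open>L_le\<close>.\<close>
  define t where "t = (LEAST t. 8 * p < 4 ^ t)"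
  have "8 * p < 4 ^ (8 * p)" by (rule less_exp[THEN less_le_trans]) (simp add: power_mono)
  then have t: "8 * p < 4 ^ t" unfolding t_def by (rule LeastI)
  have "(4::nat) ^ 20 < 4 ^ t" using t assms(2) by linarith
  then have t20: "t > 20" by (rule power_less_imp_less_exp[rotated]) simp
  have "\<not> 8 * p < 4 ^ (t - 1)" using not_less_Least[of "t - 1" "\<lambda>t. 8 * p < 4 ^ t"] t20 by (simp add: t_def)
  then have t_le: "4 ^ t \<le> 32 * p" using t20 by (simp add: power_eq_if)
  define L where "L = 2 * t - 2"
  have pow: "(2::int) ^ L * 4 = 4 ^ t"
  proof -
    have "(4::int) ^ t = (2 ^ 2) ^ t" by simp
    also have "\<dots> = 2 ^ (2 * t)" by (simp only: power_mult)
    also have "2 * t = L + 2" using t20 by (simp add: L_def)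
    finally show ?thesis by (simp add: power_add)
  qed
  have pow': "(2::int) ^ (L - 1) * 2 = 2 ^ L" using t20 by (simp add: L_def power_eq_if)
  have "int (8 * p) < int (4 ^ t)" "int (4 ^ t) \<le> int (32 * p)"
    using t t_le by (simp_all only: of_nat_less_iff of_nat_le_iff)
  then have intt: "8 * int p < 4 ^ t" "4 ^ t \<le> 32 * int p" by simp_all
  then have "int p \<le> 2 ^ (L - 1)" using pow pow' by linarith
  moreover have "L \<ge> 1" using t20 by (simp add: L_def)
  ultimately obtain d e where de: "d 0 = 12 * int t + 6"
    "\<And>j. j < L \<Longrightarrow> d (Suc j) = (if e j then 2 * d j - 2 else - 2 * d j - 2)" "[d L = 1] (mod int p)"
    using chain_digits[OF assms(1), of L "12 * int t + 6"] by blast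
  interpret chain p "int t" L d e
  proof (rule chain.intro; (fact assms(1) de)?)
    show "2 * int t = int L + 2" using t20 by (simp add: L_def)
    show "2 ^ L \<le> 8 * int p" using pow intt by simp
    show "16 * (8 * (8 * int t + 2) * (16 * int t + 8) + 4 * int t + 1) * (16 * int t + 8) < int p"
      using poly_less_power4[of t] t20 intt by simp
    show "3 \<le> int t" using t20 by simp
  qed
  obtain T where T: "is_transversal p (cyclic_square p) T" "T \<noteq> main_diagonal p"
    "card {t \<in> T. fst t \<noteq> fst (snd t)} \<le> 6 * L + 18"
    using transversal_exists by blast
  \<comment> \<open>Squaring \<open>p\<close> absorbs the factor 32; as \<open>ln 4 \<ge> 1\<close>,
    this gives \<open>t \<le> 2 * ln p\<close>, and 26 is 13 * 2.\<close>
  have "(4::nat) ^ t \<le> p ^ 2"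
  proof -
    have "32 * p \<le> p * p" using assms(2) by (intro mult_right_mono) auto
    then show ?thesis using t_le unfolding power2_eq_square by linarith
  qed
  then have "real (4 ^ t) \<le> real (p ^ 2)" by (simp only: of_nat_le_iff)
  then have "(4::real) ^ t \<le> real p ^ 2" by simp
  then have "ln ((4::real) ^ t) \<le> ln (real p ^ 2)" by (intro ln_mono) auto
  then have "real t * ln 4 \<le> 2 * ln (real p)"
    using assms(2) by (simp add: ln_realpow)
  moreover have "real t * 1 \<le> real t * ln 4"
    using exp_le by (intro mult_left_mono) (auto simp: ln_ge_iff)
  ultimately have "real t \<le> 2 * ln (real p)" by linarith
  moreover have "real (6 * L + 18) \<le> 13 * real t" using t20 by (simp add: L_def of_nat_diff)
  ultimately have "real (card {t \<in> T. fst t \<noteq> fst (snd t)}) \<le> 26 * ln (real p)"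
    using T(3) by linarith
  then show ?thesis using T by blast
qed

theorem theorem6p3:
  shows "\<exists>C::real. C > 0 \<and>
    (\<forall>p::nat. prime p \<and> odd p \<longrightarrow>
      (\<exists>T. is_transversal p (cyclic_square p) T \<and> T \<noteq> main_diagonal p \<and>
           real (card {t \<in> T. fst t \<noteq> fst (snd t)}) \<le> C * ln (real p)))"
\<comment> \<open>The constant makes the bound \<open>p\<close> of the shifted diagonal sufficient
  up to \<open>4 ^ 20\<close>, since \<open>ln p \<ge> 1\<close> for
  \<open>p \<ge> 3\<close>.\<close>
proof (intro exI[of _ "4 ^ 20"] conjI allI impI)
  fix p :: nat assume p: "prime p \<and> odd p"
  then have p3: "p \<ge> 3" using prime_ge_2_nat[of p] by (cases "p = 2") auto
  then have ln1: "ln (real p) \<ge> 1" using exp_le by (simp add: ln_ge_iff)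
  show "\<exists>T. is_transversal p (cyclic_square p) T \<and> T \<noteq> main_diagonal p \<and>
           real (card {t \<in> T. fst t \<noteq> fst (snd t)}) \<le> 4 ^ 20 * ln (real p)"
  proof (cases "p > 4 ^ 20")
    case True
    then obtain T where T: "is_transversal p (cyclic_square p) T" "T \<noteq> main_diagonal p"
      "real (card {t \<in> T. fst t \<noteq> fst (snd t)}) \<le> 26 * ln (real p)"
      using transversal_large p by blast
    moreover have "26 * ln (real p) \<le> 4 ^ 20 * ln (real p)" using ln1 by (intro mult_right_mono) auto
    ultimately show ?thesis by (intro exI[of _ T]) auto
  next
    case False
    obtain T where T: "is_transversal p (cyclic_square p) T" "T \<noteq> main_diagonal p"
      "card {t \<in> T. fst t \<noteq> fst (snd t)} \<le> p"
      using transversal_shift p p3 by blast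
    have "real p \<le> 4 ^ 20 * 1" using False by (simp add: not_less)
    also have "\<dots> \<le> 4 ^ 20 * ln (real p)" using ln1 by (intro mult_left_mono) auto
    finally show ?thesis using T by (intro exI[of _ T]) auto
  qed
qed simp

end
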